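(* Let $R$ be a residually solvable Leibniz algebra over $\mathbb{C}$ whose maximal by inclusion pro-nilpotent ideal is $F$, with $F$ of codimension $1$ in $R$. Then $R$ admits a basis $\{x,e_1,e_2,\dots\}$ on which its multiplication table has one of the following forms: (1) $R_1(F,1,\beta)$: $[e_i,e_1]=e_{i+1}$ for $i\ge 2$; $[e_1,x]=-[x,e_1]=e_1$; $[e_i,x]=(i-2+\beta_2)e_i+\sum_{k=3}^{t}\beta_k e_{k+i-2}$ for $i\ge 2$, where $\beta=(\beta_2,\beta_3,\dots,\beta_t)\in\mathbb{C}^{t-1}$ for some $t\in\mathbb{N}$; (2) $R_2(F,1,\beta)$: $[e_i,e_1]=e_{i+1}$ for $i\ge 2$; $[x,e_1]=-e_1+e_2$; $[e_1,x]=e_1$; $[e_i,x]=(i-1)e_i+\sum_{k=3}^{t}\beta_k e_{k+i-2}$ for $i\ge 2$; $[x,x]=\sum_{k=2}^{t-1}\beta_{k+1}e_k$, where $\beta=(\beta_3,\beta_4,\dots,\beta_t)\in\mathbb{C}^{t-2}$ for some $t\in\mathbb{N}$; (3) $R_3(F,1,\beta)$: $[e_i,e_1]=e_{i+1}$ for $i\ge 2$; $[e_i,x]=e_i+\sum_{k=3}^{t}\beta_k e_{k+i-2}$ for $i\ge 2$, where $\beta=(\beta_3,\beta_4,\dots,\beta_t)\in\mathbb{C}^{t-2}$ for some $t\in\mathbb{N}$.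
   Context: All algebras are over $\mathbb{C}$ and have a countable basis, every element being a finite linear combination of basis elements. A Leibniz algebra is an algebra with bilinear product $[\cdot,\cdot]$ satisfying $[a,[b,c]]=[[a,b],c]-[[a,c],b]$ for all $a,b,c$. In multiplication tables of Leibniz algebras, products of basis elements that are not listed are zero (no antisymmetry is assumed); empty sums are zero. $F$ is the infinite-dimensional Leibniz algebra with basis $\{e_1,e_2,\dots\}$ and only nonzero products $[e_i,e_1]=e_{i+1}$ for $i\ge 2$. For an algebra $L$, set $L^1=L$, $L^{k+1}=[L^k,L]$ and $L^{[1]}=L$, $L^{[s+1]}=[L^{[s]},L^{[s]}]$. $L$ is residually solvable if $\bigcap_{i\ge1}L^{[i]}=0$. $L$ is pro-nilpotent if $\bigcap_{i\ge1}L^{i}=0$ and $\dim(L/L^i)<\infty$ for all $i\ge 1$. "The maximal by inclusion pro-nilpotent ideal of $R$ is $F$" means that $F$ is (isomorphic to) an ideal of $R$ that is maximal with respect to inclusion among pro-nilpotent ideals of $R$. *)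

theory Defs
  imports Complex_Main "HOL-Library.Countable_Set"
begin

text \<open>The algebra is the whole type \<open>'a\<close>; subalgebras and ideals are subspaces of it.\<close>

locale leibniz_algebra = vector_space scale
  for scale :: "complex \<Rightarrow> 'a::ab_group_add \<Rightarrow> 'a" (infixr \<open>*s\<close> 75) +
  fixes br :: "'a \<Rightarrow> 'a \<Rightarrow> 'a"
  assumes countable_basis: "\<exists>B. countable B \<and> independent B \<and> span B = UNIV"
    and br_linear_left: "Vector_Spaces.linear (*s) (*s) (\<lambda>a. br a b)"
    and br_linear_right: "Vector_Spaces.linear (*s) (*s) (\<lambda>b. br a b)"
    and leibniz: "br a (br b c) = br (br a b) c - br (br a c) b"
begin

definition set_br :: "'a set \<Rightarrow> 'a set \<Rightarrow> 'a set" where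
  "set_br A B = span {br a b | a b. a \<in> A \<and> b \<in> B}"

text \<open>Both series start at index 0: \<open>lower_central L k\<close> is $L^{k+1}$ and
  \<open>derived L s\<close> is $L^{[s+1]}$.\<close>

primrec lower_central :: "'a set \<Rightarrow> nat \<Rightarrow> 'a set" where
  "lower_central L 0 = L"
| "lower_central L (Suc k) = set_br (lower_central L k) L"

primrec derived :: "'a set \<Rightarrow> nat \<Rightarrow> 'a set" where
  "derived L 0 = L"
| "derived L (Suc s) = set_br (derived L s) (derived L s)"

definition residually_solvable :: "'a set \<Rightarrow> bool" where
  "residually_solvable L \<longleftrightarrow> (\<Inter>s. derived L s) = {0}"

text \<open>For subspaces \<open>M \<subseteq> L\<close>: the cosets \<open>v + M\<close>, \<open>v \<in> B\<close>, are pairwise distinct and form a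
  basis of the quotient space \<open>L / M\<close>.\<close>

definition quotient_basis :: "'a set \<Rightarrow> 'a set \<Rightarrow> 'a set \<Rightarrow> bool" where
  "quotient_basis L M B \<longleftrightarrow>
     B \<subseteq> L \<and> span (B \<union> M) = L \<and>
     (\<forall>T c. finite T \<and> T \<subseteq> B \<and> (\<Sum>v\<in>T. c v *s v) \<in> M \<longrightarrow> (\<forall>v\<in>T. c v = 0))"

definition finite_dim_quotient :: "'a set \<Rightarrow> 'a set \<Rightarrow> bool" where
  "finite_dim_quotient L M \<longleftrightarrow> (\<exists>B. finite B \<and> quotient_basis L M B)"

definition has_codim :: "'a set \<Rightarrow> 'a set \<Rightarrow> nat \<Rightarrow> bool" where
  "has_codim L M n \<longleftrightarrow> (\<exists>B. finite B \<and> card B = n \<and> quotient_basis L M B)"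

definition pro_nilpotent :: "'a set \<Rightarrow> bool" where
  "pro_nilpotent L \<longleftrightarrow>
     (\<Inter>k. lower_central L k) = {0} \<and> (\<forall>k. finite_dim_quotient L (lower_central L k))"

definition ideal :: "'a set \<Rightarrow> bool" where
  "ideal I \<longleftrightarrow> subspace I \<and> (\<forall>a\<in>I. \<forall>r. br a r \<in> I \<and> br r a \<in> I)"

definition maximal_pro_nilpotent_ideal :: "'a set \<Rightarrow> bool" where
  "maximal_pro_nilpotent_ideal N \<longleftrightarrow>
     ideal N \<and> pro_nilpotent N \<and>
     (\<forall>J. ideal J \<and> pro_nilpotent J \<and> N \<subseteq> J \<longrightarrow> J = N)"

text \<open>Sequences \<open>e\<close> of basis vectors are indexed from 1; the value \<open>e 0\<close> is never used.
  The next table is that of the products of the \<open>e i\<close> in $F$.\<close>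

definition F_table :: "(nat \<Rightarrow> 'a) \<Rightarrow> bool" where
  "F_table e \<longleftrightarrow>
     (\<forall>i\<ge>2. br (e i) (e 1) = e (i + 1)) \<and>
     br (e 1) (e 1) = 0 \<and>
     (\<forall>i\<ge>1. \<forall>j\<ge>2. br (e i) (e j) = 0)"

text \<open>The subalgebra \<open>N\<close> is isomorphic to $F$.\<close>

definition is_F :: "'a set \<Rightarrow> bool" where
  "is_F N \<longleftrightarrow>
     (\<exists>e. inj_on e {1..} \<and> independent (e ` {1..}) \<and> span (e ` {1..}) = N \<and> F_table e)"

definition is_basis :: "'a \<Rightarrow> (nat \<Rightarrow> 'a) \<Rightarrow> bool" where
  "is_basis x e \<longleftrightarrow>
     inj_on e {1..} \<and> x \<notin> e ` {1..} \<and>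
     independent (insert x (e ` {1..})) \<and> span (insert x (e ` {1..})) = UNIV"

text \<open>Of the parameter \<open>\<beta>\<close> only the entries \<open>\<beta> 2, \<dots>, \<beta> t\<close> (for \<open>R1_table\<close>) or
  \<open>\<beta> 3, \<dots>, \<beta> t\<close> (for the other two) occur.\<close>

definition R1_table :: "nat \<Rightarrow> (nat \<Rightarrow> complex) \<Rightarrow> 'a \<Rightarrow> (nat \<Rightarrow> 'a) \<Rightarrow> bool" where
  "R1_table t \<beta> x e \<longleftrightarrow>
     F_table e \<and>
     br (e 1) x = e 1 \<and>
     br x (e 1) = - e 1 \<and>
     (\<forall>i\<ge>2. br (e i) x = (of_nat i - 2 + \<beta> 2) *s e i + (\<Sum>k=3..t. \<beta> k *s e (k + i - 2))) \<and>
     (\<forall>i\<ge>2. br x (e i) = 0) \<and>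
     br x x = 0"

definition R2_table :: "nat \<Rightarrow> (nat \<Rightarrow> complex) \<Rightarrow> 'a \<Rightarrow> (nat \<Rightarrow> 'a) \<Rightarrow> bool" where
  "R2_table t \<beta> x e \<longleftrightarrow>
     F_table e \<and>
     br x (e 1) = - e 1 + e 2 \<and>
     br (e 1) x = e 1 \<and>
     (\<forall>i\<ge>2. br (e i) x = (of_nat i - 1) *s e i + (\<Sum>k=3..t. \<beta> k *s e (k + i - 2))) \<and>
     (\<forall>i\<ge>2. br x (e i) = 0) \<and>
     br x x = (\<Sum>k=2..t - 1. \<beta> (k + 1) *s e k)"

definition R3_table :: "nat \<Rightarrow> (nat \<Rightarrow> complex) \<Rightarrow> 'a \<Rightarrow> (nat \<Rightarrow> 'a) \<Rightarrow> bool" where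
  "R3_table t \<beta> x e \<longleftrightarrow>
     F_table e \<and>
     br (e 1) x = 0 \<and>
     (\<forall>i\<ge>2. br (e i) x = e i + (\<Sum>k=3..t. \<beta> k *s e (k + i - 2))) \<and>
     (\<forall>i\<ge>1. br x (e i) = 0) \<and>
     br x x = 0"

end

end

theory Submission
  imports Defs "HOL-Computational_Algebra.Polynomial"
begin

text \<open>
  Write \<open>V\<close> for the span of \<open>e\<^sub>2, e\<^sub>3, \<dots>\<close>.  Right multiplication by \<open>e\<^sub>1\<close> shifts the basis of \<open>V\<close>,
  so \<open>V\<close> is the polynomial ring \<open>\<complex>[T]\<close> with \<open>e\<^sub>2\<close> as \<open>1\<close> and \<open>e\<^sub>i\<close> as \<open>T\<^bsup>i-2\<^esup>\<close>, and every identity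
  inside the ideal \<open>N\<close> becomes an identity of polynomials.  The map \<open>comb e i\<close> below sends a
  polynomial \<open>p\<close> to the vector \<open>p(T) e\<^sub>i\<close>.

  Let \<open>x\<close> span a complement of \<open>N\<close>.  The Leibniz identity says that right multiplication by \<open>x\<close> is a
  derivation.  Since \<open>e\<^sub>1\<close> and \<open>e\<^sub>2\<close> generate \<open>N\<close>, it is determined on \<open>N\<close> by its values there, and
  \<open>[e\<^sub>1,e\<^sub>1] = [e\<^sub>2,e\<^sub>2] = 0\<close> forces \<open>[e\<^sub>1,x] = a e\<^sub>1\<close> and \<open>[e\<^sub>2,x] = q \<in> V\<close> (\<open>right_mult\<close>).
  The elements \<open>[b,b]\<close> and \<open>[b,c] + [c,b]\<close> are annihilated by all left multiplications, whereas
  \<open>[e\<^sub>2, e\<^sub>1] = e\<^sub>3 \<noteq> 0\<close>; so such an element, if it lies in \<open>N\<close>, lies in \<open>V\<close>.  This gives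
  \<open>[x,e\<^sub>1] = -a e\<^sub>1 + r\<close> and \<open>[x,x] = u\<close> with \<open>r, u \<in> V\<close>, and \<open>[x,e\<^sub>i] = 0\<close> for \<open>i \<ge> 2\<close>; the Leibniz
  identity for \<open>x, x, e\<^sub>1\<close> leaves the single relation \<open>[r,x] = a r + T u\<close> (\<open>left_mult\<close>).

  Subtracting an element of \<open>V\<close> from \<open>x\<close> changes \<open>r\<close> by an arbitrary multiple of \<open>T\<close>, so \<open>r\<close> may be
  taken to be a scalar \<open>\<rho>\<close>; the relation is then the polynomial identity \<open>\<rho> q = a \<rho> + T u\<close>
  (\<open>normalized_complement\<close>).  The three families come from the cases it allows.

  If \<open>a \<noteq> 0\<close>, scale \<open>x\<close> to get \<open>a = 1\<close>.  Either \<open>\<rho> = 0\<close>, hence \<open>u = 0\<close>, which is the first family, or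
  \<open>\<rho> \<noteq> 0\<close>; then replacing \<open>e\<^sub>i\<close> by \<open>\<rho> e\<^sub>i\<close> for \<open>i \<ge> 2\<close> reduces to \<open>\<rho> = 1\<close> and \<open>q = 1 + T u\<close>, which is the
  second family.

  If \<open>a = 0\<close>, maximality of \<open>N\<close> enters: were the constant term of \<open>q\<close> zero, all right
  multiplications would push \<open>V\<close> one step down its filtration by the spans of \<open>e\<^sub>i, e\<^sub>i\<^sub>+\<^sub>1, \<dots>\<close>, and the
  whole algebra would be pro-nilpotent (\<open>pro_nilpotent_UNIV\<close>).  So that term can be scaled to \<open>1\<close>, and the
  identity \<open>\<rho> q = T u\<close> forces \<open>\<rho> = 0\<close> and \<open>u = 0\<close>: the third family.
\<close>

section \<open>Products in Leibniz algebras\<close>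

context leibniz_algebra
begin

lemma br_add_left: "br (a + b) c = br a c + br b c"
  using br_linear_left[of c] by (simp add: Vector_Spaces.linear_iff)

lemma br_add_right: "br c (a + b) = br c a + br c b"
  using br_linear_right[of c] by (simp add: Vector_Spaces.linear_iff)

lemma br_scale_left: "br (k *s a) c = k *s br a c"
  using br_linear_left[of c] by (simp add: Vector_Spaces.linear_iff)

lemma br_scale_right: "br c (k *s a) = k *s br c a"
  using br_linear_right[of c] by (simp add: Vector_Spaces.linear_iff)

lemma br_zero_left: "br 0 c = 0"
  using br_scale_left[of 0 0 c] by simp

lemma br_zero_right: "br c 0 = 0"
  using br_scale_right[of c 0 0] by simp

lemma br_minus_left: "br (- a) c = - br a c"
  using br_scale_left[of "-1" a c] by simp

lemma br_minus_right: "br c (- a) = - br c a"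
  using br_scale_right[of c "-1" a] by simp

lemma br_diff_left: "br (a - b) c = br a c - br b c"
  using br_add_left[of a "- b" c] by (simp add: br_minus_left)

lemma br_diff_right: "br c (a - b) = br c a - br c b"
  using br_add_right[of c a "- b"] by (simp add: br_minus_right)

lemmas br_bilinear = br_add_left br_add_right br_scale_left br_scale_right
  br_zero_left br_zero_right br_minus_left br_minus_right br_diff_left br_diff_right

lemma br_square_right: "br a (br b b) = 0"
  by (simp add: leibniz)

text \<open>The right-hand side of the Leibniz identity changes sign when \<open>b\<close> and \<open>c\<close> are exchanged.\<close>

lemma br_symmetric_right: "br a (br b c + br c b) = 0"
  by (simp add: leibniz br_add_right)

lemma derivation_right: "br (br a b) x = br a (br b x) + br (br a x) b"
  by (simp add: leibniz)

lemma br_span_subset: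
  assumes "subspace W" "\<And>a b. a \<in> A \<Longrightarrow> b \<in> B \<Longrightarrow> br a b \<in> W" "y \<in> span A" "z \<in> span B"
  shows "br y z \<in> W"
proof -
  have 1: "br a z \<in> W" if "a \<in> A" for a
    using \<open>z \<in> span B\<close>
  proof (induction rule: span_induct_alt)
    case base
    show ?case using assms(1) by (simp add: br_zero_right subspace_0)
  next
    case (step c b w)
    then show ?case
      using assms(1,2) that by (simp add: br_bilinear subspace_add subspace_scale)
  qed
  show ?thesis
    using \<open>y \<in> span A\<close>
  proof (induction rule: span_induct_alt)
    case base
    show ?case using assms(1) by (simp add: br_zero_left subspace_0)
  next
    case (step c b w)
    then show ?case
      using assms(1) 1 by (simp add: br_bilinear subspace_add subspace_scale)
  qed
qed

lemma set_br_span_subset: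
  assumes "subspace W" "\<And>a b. a \<in> A \<Longrightarrow> b \<in> B \<Longrightarrow> br a b \<in> W"
  shows "set_br (span A) (span B) \<subseteq> W"
  unfolding set_br_def
  by (rule span_minimal) (use br_span_subset[OF assms] assms(1) in auto)

lemma set_br_mono: "A \<subseteq> A' \<Longrightarrow> B \<subseteq> B' \<Longrightarrow> set_br A B \<subseteq> set_br A' B'"
  unfolding set_br_def by (rule span_mono) auto

lemma br_in_set_br: "a \<in> A \<Longrightarrow> b \<in> B \<Longrightarrow> br a b \<in> set_br A B"
  unfolding set_br_def by (rule span_base) auto

section \<open>Finite-dimensional quotients and rescaled bases\<close>

text \<open>Extend a basis \<open>C\<close> of \<open>M\<close> by vectors of \<open>S\<close> to a basis of the span of \<open>C \<union> S\<close>; the added vectors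
  are independent modulo \<open>M\<close>.\<close>

lemma finite_dim_quotientI:
  assumes "finite S" "span (S \<union> M) = UNIV" "subspace M"
  shows "finite_dim_quotient UNIV M"
proof -
  obtain C where C: "C \<subseteq> M" "independent C" "M \<subseteq> span C"
    using maximal_independent_subset[of M] by metis
  obtain D where D: "C \<subseteq> D" "D \<subseteq> C \<union> S" "independent D" "C \<union> S \<subseteq> span D"
    using maximal_independent_subset_extend[of C "C \<union> S"] C(2) by blast
  have MC: "span C = M"
    using C assms(3) by (simp add: span_subspace)
  have "S \<union> M \<subseteq> span (D - C \<union> M)"
  proof -
    have "D \<subseteq> D - C \<union> M" using C by auto
    then have "span D \<subseteq> span (D - C \<union> M)" by (rule span_mono)
    then show ?thesis using D(4) by (auto intro: span_base)
  qed
  then have "span (S \<union> M) \<subseteq> span (D - C \<union> M)"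
    by (simp add: span_minimal)
  then have sp: "span (D - C \<union> M) = UNIV" using assms(2) by auto
  have ind: "c v = 0" if T: "finite T" "T \<subseteq> D - C" "(\<Sum>v\<in>T. c v *s v) \<in> M" and v: "v \<in> T" for T c v
  proof -
    have "(\<Sum>v\<in>T. c v *s v) \<in> span C" using T MC by simp
    then obtain t r where tr: "finite t" "t \<subseteq> C" "(\<Sum>v\<in>T. c v *s v) = (\<Sum>a\<in>t. r a *s a)"
      unfolding span_explicit by auto
    have dis: "T \<inter> t = {}" using T tr by auto
    define u where "u = (\<lambda>w. if w \<in> T then c w else - r w)"
    have "(\<Sum>w\<in>T \<union> t. u w *s w) = (\<Sum>w\<in>T. u w *s w) + (\<Sum>w\<in>t. u w *s w)"
      using T(1) tr(1) dis by (rule sum.union_disjoint)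
    also have "(\<Sum>w\<in>T. u w *s w) = (\<Sum>w\<in>T. c w *s w)"
      by (simp add: u_def)
    also have "(\<Sum>w\<in>t. u w *s w) = (\<Sum>w\<in>t. - (r w *s w))"
      using dis by (intro sum.cong) (auto simp: u_def)
    finally have "(\<Sum>w\<in>T \<union> t. u w *s w) = 0" using tr(3) by (simp add: sum_negf)
    moreover have "T \<union> t \<subseteq> D" using T tr D by auto
    ultimately have "u v = 0"
      using independentD[OF D(3), of "T \<union> t" u v] T(1) tr(1) v by auto
    then show ?thesis using v by (simp add: u_def)
  qed
  have "finite (D - C)" using D(2) assms(1) by (auto intro: finite_subset)
  moreover have "quotient_basis UNIV M (D - C)"
    unfolding quotient_basis_def using sp ind by blast
  ultimately show ?thesis unfolding finite_dim_quotient_def by blast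
qed

lemma independent_rescale:
  assumes "independent S" "\<And>v. v \<in> S \<Longrightarrow> c v \<noteq> 0"
  shows "inj_on (\<lambda>v. c v *s v) S" "independent ((\<lambda>v. c v *s v) ` S)"
    "span ((\<lambda>v. c v *s v) ` S) = span S"
proof -
  let ?f = "\<lambda>v. c v *s v"
  have unscale: "v \<in> span X" if "?f v \<in> span X" "v \<in> S" for v X
    using span_scale[OF that(1), of "inverse (c v)"] assms(2)[OF that(2)] by simp
  have sub: "span (?f ` X) \<subseteq> span X" for X
    by (rule span_minimal) (auto intro: span_scale span_base)
  have notin: "?f v \<notin> span (S - {v})" if "v \<in> S" for v
    using unscale[of v "S - {v}"] that assms(1) by (auto simp: dependent_def)
  show "inj_on ?f S"
  proof (rule inj_onI, rule ccontr)
    fix v w assume *: "v \<in> S" "w \<in> S" "?f v = ?f w" "v \<noteq> w"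
    then have "?f w \<in> span (S - {v})" by (intro span_scale span_base) auto
    then show False using notin[of v] * by simp
  qed
  show "independent (?f ` S)"
  proof
    assume "dependent (?f ` S)"
    then obtain v where v: "v \<in> S" "?f v \<in> span (?f ` S - {?f v})"
      unfolding dependent_def by auto
    have "?f ` S - {?f v} \<subseteq> ?f ` (S - {v})" by auto
    then have "?f v \<in> span (S - {v})" using v(2) sub span_mono by blast
    then show False using notin[OF v(1)] by simp
  qed
  have "S \<subseteq> span (?f ` S)"
  proof
    fix v assume v: "v \<in> S"
    then have "?f v \<in> span (?f ` S)" by (intro span_base imageI)
    then show "v \<in> span (?f ` S)" using v by (rule unscale)
  qed
  then show "span (?f ` S) = span S"
    using sub by (simp add: span_minimal subset_antisym)
qed

section \<open>Combinations of consecutive basis vectors as polynomials\<close>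

text \<open>This is \<open>p(T) e\<^sub>i\<close> for the shift \<open>T\<close> with \<open>T e\<^sub>j = e\<^sub>j\<^sub>+\<^sub>1\<close>.  Keeping the starting index \<open>i\<close> as an
  argument lets facts be proved by induction on \<open>p\<close> with \<open>i\<close> arbitrary.\<close>

definition comb :: "(nat \<Rightarrow> 'a) \<Rightarrow> nat \<Rightarrow> complex poly \<Rightarrow> 'a" where
  "comb e i p = (\<Sum>j\<le>degree p. coeff p j *s e (i + j))"

lemma comb_0 [simp]: "comb e i 0 = 0"
  by (simp add: comb_def)

lemma comb_pCons: "comb e i (pCons a p) = a *s e i + comb e (Suc i) p"
proof (cases "p = 0")
  case True
  then show ?thesis by (simp add: comb_def)
next
  case False
  then show ?thesis
    by (simp add: comb_def sum.atMost_Suc_shift del: sum.atMost_Suc)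
qed

lemma comb_Suc: "comb e (Suc i) p = comb e i (pCons 0 p)"
  by (simp add: comb_pCons)

lemma comb_add: "comb e i (p + q) = comb e i p + comb e i q"
  by (induction p q arbitrary: i rule: poly_induct2) (simp_all add: comb_pCons algebra_simps)

lemma comb_smult: "comb e i (smult c p) = c *s comb e i p"
  by (induction p arbitrary: i) (simp_all add: comb_pCons algebra_simps)

lemma comb_diff: "comb e i (p - q) = comb e i p - comb e i q"
  using comb_add[of e i "p - q" q] by (simp add: algebra_simps)

lemma comb_in_span: "comb e i p \<in> span (e ` {i..})"
  unfolding comb_def by (intro span_sum span_scale span_base) auto

lemma span_eq_range_comb: "span (e ` {i..}) = range (comb e i)"
proof
  show "range (comb e i) \<subseteq> span (e ` {i..})" using comb_in_span by auto
  have gen: "e j \<in> range (comb e i)" if "j \<ge> i" for j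
  proof -
    have "comb e i (monom 1 (j - i)) = e j" using that
    proof (induction j arbitrary: rule: dec_induct)
      case base
      show ?case by (simp add: comb_pCons monom_0)
    next
      case (step n)
      show ?case
        using step.hyps by (simp add: comb_def degree_monom_eq if_distrib[of "\<lambda>c. c *s _"] cong: if_cong)
    qed
    then show ?thesis by (metis rangeI)
  qed
  have "subspace (range (comb e i))"
    unfolding subspace_def
    by (auto simp flip: comb_add comb_smult intro: range_eqI[of _ _ 0])
  then show "span (e ` {i..}) \<subseteq> range (comb e i)"
    by (intro span_minimal) (auto intro: gen)
qed

text \<open>A vector in the span of \<open>e\<^sub>i\<^sub>+\<^sub>k, e\<^sub>i\<^sub>+\<^sub>k\<^sub>+\<^sub>1, \<dots>\<close> corresponds to a polynomial divisible by \<open>T\<^bsup>k\<^esup>\<close>; this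
  is why the filtration by these spans has zero intersection.\<close>

lemma comb_shift: "comb e (i + k) p = comb e i (monom 1 k * p)"
  by (induction k arbitrary: i) (simp_all add: monom_0 monom_Suc comb_pCons flip: add_Suc)

lemma br_comb_right_zero:
  assumes "\<And>j. j \<ge> i \<Longrightarrow> br y (e j) = 0"
  shows "br y (comb e i p) = 0"
  using assms by (induction p arbitrary: i) (simp_all add: comb_pCons br_bilinear)

end

section \<open>Algebras with an ideal isomorphic to F\<close>

locale F_ideal = leibniz_algebra scale br
  for scale :: "complex \<Rightarrow> 'a::ab_group_add \<Rightarrow> 'a" (infixr \<open>*s\<close> 75) and br +
  fixes e :: "nat \<Rightarrow> 'a" and N :: "'a set"
  assumes inj_e: "inj_on e {1..}"
    and independent_e: "independent (e ` {1..})"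
    and span_e: "span (e ` {1..}) = N"
    and F_table_e: "F_table e"
    and ideal_N: "ideal N"
begin

text \<open>Normalisation replaces \<open>x\<close> several times; only this property of \<open>x\<close> has to be carried along.\<close>

definition complement :: "'a \<Rightarrow> bool" where
  "complement x \<longleftrightarrow> x \<notin> N \<and> span (insert x N) = UNIV"

lemma br_e_e1: "i \<ge> 2 \<Longrightarrow> br (e i) (e 1) = e (Suc i)"
  using F_table_e by (simp add: F_table_def)

lemma br_e1_e1: "br (e 1) (e 1) = 0"
  using F_table_e by (simp add: F_table_def)

lemma br_e_e: "i \<ge> 1 \<Longrightarrow> j \<ge> 2 \<Longrightarrow> br (e i) (e j) = 0"
  using F_table_e by (simp add: F_table_def)

lemma br_comb_e1: "i \<ge> 2 \<Longrightarrow> br (comb e i p) (e 1) = comb e (Suc i) p"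
  by (induction p arbitrary: i) (simp_all add: comb_pCons br_bilinear br_e_e1 del: One_nat_def)

lemma br_e_comb: "i \<ge> 1 \<Longrightarrow> j \<ge> 2 \<Longrightarrow> br (e i) (comb e j p) = 0"
  by (rule br_comb_right_zero) (auto intro: br_e_e)

lemma br_comb_e: "i \<ge> 1 \<Longrightarrow> j \<ge> 2 \<Longrightarrow> br (comb e i p) (e j) = 0"
  by (induction p arbitrary: i) (simp_all add: comb_pCons br_bilinear br_e_e del: One_nat_def)

lemma subspace_N: "subspace N"
  using ideal_N by (simp add: ideal_def)

lemma comb_in_N: "i \<ge> 1 \<Longrightarrow> comb e i p \<in> N"
  unfolding span_e[symmetric] comb_def by (intro span_sum span_scale span_base) auto

lemma e_in_N: "i \<ge> 1 \<Longrightarrow> e i \<in> N"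
  unfolding span_e[symmetric] by (intro span_base) auto

lemma comb_eq_0_iff:
  assumes "i \<ge> 1"
  shows "comb e i p = 0 \<longleftrightarrow> p = 0"
proof
  assume *: "comb e i p = 0"
  define S where "S = (\<lambda>j. e (i + j)) ` {..degree p}"
  have inj: "inj_on (\<lambda>j. e (i + j)) {..degree p}"
    using assms by (intro inj_onI) (auto dest: inj_onD[OF inj_e])
  define u where "u = (\<lambda>v. coeff p (the_inv_into {..degree p} (\<lambda>j. e (i + j)) v))"
  have u: "u (e (i + j)) = coeff p j" if "j \<le> degree p" for j
    using the_inv_into_f_f[OF inj] that by (simp add: u_def)
  have "(\<Sum>v\<in>S. u v *s v) = comb e i p"
    unfolding S_def comb_def by (subst sum.reindex[OF inj]) (simp add: u)
  then have "u (e (i + degree p)) = 0"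
    using * assms by (intro independentD[OF independent_e, of S]) (auto simp: S_def)
  then show "p = 0" by (simp add: u)
qed simp

lemma comb_eq_iff: "i \<ge> 1 \<Longrightarrow> comb e i p = comb e i q \<longleftrightarrow> p = q"
  using comb_eq_0_iff[of i "p - q"] by (simp add: comb_diff)

lemma in_N_cases:
  assumes "z \<in> N"
  obtains c p where "z = c *s e 1 + comb e 2 p"
proof -
  obtain p where "z = comb e 1 p"
    using assms span_e span_eq_range_comb[of e 1] by auto
  then show ?thesis
    using that by (cases p) (auto simp: comb_pCons numeral_2_eq_2)
qed

lemma e_nonzero: "i \<ge> 1 \<Longrightarrow> e i \<noteq> 0"
  using comb_eq_0_iff[of i "[:1:]"] by (simp add: comb_pCons del: pCons_one)

text \<open>Left multiplication by \<open>e\<^sub>2\<close> detects the \<open>e\<^sub>1\<close>-coordinate of an element of \<open>N\<close>.\<close>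

lemma br_e2: "br (e 2) (c *s e 1 + comb e 2 p) = c *s e 3"
  by (simp add: br_bilinear br_e_e1 br_e_comb del: One_nat_def)

text \<open>The quotient by \<open>N\<close> is a line in which \<open>[x,x] = l x\<close>.  Since \<open>[x,[x,x]] = 0\<close>, also
  \<open>l\<^sup>2 x = 0\<close> there, so \<open>l = 0\<close>.\<close>

lemma br_in_N:
  assumes "complement x"
  shows "br x x \<in> N"
proof -
  have "br x x \<in> span (insert x N)" using assms by (simp add: complement_def)
  then obtain l where l: "br x x - l *s x \<in> N"
    using span_eq_iff[THEN iffD2, OF subspace_N] by (auto simp: span_breakdown_eq)
  define n where "n = br x x - l *s x"
  have xx: "br x x = l *s x + n" by (simp add: n_def)
  have "br x n \<in> N" using ideal_N l by (simp add: ideal_def n_def)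
  moreover have "l *s br x x + br x n = 0"
    using br_square_right[of x x] unfolding xx by (simp add: br_bilinear xx)
  ultimately have "l *s br x x \<in> N"
    using subspace_neg[OF subspace_N] by (metis add_eq_0_iff add.commute)
  moreover have "l *s n \<in> N" using l by (simp add: n_def subspace_scale[OF subspace_N])
  ultimately have "l *s br x x - l *s n \<in> N" by (rule subspace_diff[OF subspace_N])
  then have *: "(l * l) *s x \<in> N" by (simp add: xx scale_right_distrib)
  have "l = 0"
  proof (rule ccontr)
    assume "l \<noteq> 0"
    then have "x \<in> N" using subspace_scale[OF subspace_N *, of "inverse (l * l)"]
      by (simp del: inverse_mult_distrib)
    then show False using assms by (simp add: complement_def)
  qed
  then show ?thesis using l by simp
qed

lemma complement_scale:
  assumes "complement x" "c \<noteq> 0"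
  shows "complement (c *s x)"
proof -
  have "x \<in> N" if "c *s x \<in> N"
    using subspace_scale[OF subspace_N that, of "inverse c"] assms(2) by simp
  moreover have "x \<in> span (insert (c *s x) N)"
    using span_scale[OF span_base, of "c *s x" "insert (c *s x) N" "inverse c"] assms(2) by simp
  then have "span (insert x N) \<subseteq> span (insert (c *s x) N)"
    by (intro span_minimal) (auto intro: span_base)
  ultimately show ?thesis using assms(1) by (auto simp: complement_def)
qed

lemma complement_diff:
  assumes "complement x" "n \<in> N"
  shows "complement (x - n)"
proof -
  have "x \<in> N" if "x - n \<in> N"
    using subspace_add[OF subspace_N that assms(2)] by simp
  moreover have "x \<in> span (insert (x - n) N)"
    using span_add[OF span_base span_base, of "x - n" "insert (x - n) N" n] assms(2) by simp
  then have "span (insert x N) \<subseteq> span (insert (x - n) N)"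
    by (intro span_minimal) (auto intro: span_base)
  ultimately show ?thesis using assms(1) by (auto simp: complement_def)
qed

lemma is_basis_complement:
  assumes "complement x"
  shows "is_basis x e"
proof -
  have "x \<notin> span (e ` {1..})" using assms span_e by (simp add: complement_def)
  moreover have "span (insert x N) \<subseteq> span (insert x (e ` {1..}))"
    unfolding span_e[symmetric]
    by (intro span_minimal) (auto intro: span_base span_mono[THEN subsetD])
  ultimately show ?thesis
    using inj_e independent_e assms
    by (auto simp: is_basis_def complement_def independent_insertI intro: span_base)
qed

section \<open>Multiplication by an element outside the ideal\<close>

text \<open>Applying the derivation \<open>[_,x]\<close> to \<open>[e\<^sub>1,e\<^sub>1] = 0\<close> removes the \<open>V\<close>-part of \<open>[e\<^sub>1,x]\<close>, and applying it
  to \<open>[e\<^sub>2,e\<^sub>2] = 0\<close> removes the \<open>e\<^sub>1\<close>-part of \<open>[e\<^sub>2,x]\<close>.\<close>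

lemma right_mult:
  assumes "complement x"
  obtains a q where "br (e 1) x = a *s e 1" "br (e 2) x = comb e 2 q"
proof -
  have "br (e 1) x \<in> N" "br (e 2) x \<in> N"
    using ideal_N e_in_N by (auto simp: ideal_def)
  then obtain a p b q where ap: "br (e 1) x = a *s e 1 + comb e 2 p"
    and bq: "br (e 2) x = b *s e 1 + comb e 2 q"
    by (metis in_N_cases)
  have "comb e 3 p = 0"
    using derivation_right[of "e 1" "e 1" x] unfolding ap br_e1_e1
    by (simp add: br_bilinear br_e1_e1 br_e_comb br_comb_e1 del: One_nat_def)
  then have "p = 0" by (simp add: comb_eq_0_iff)
  have "b *s e 3 = 0"
    using derivation_right[of "e 2" "e 2" x] unfolding bq br_e2
    by (simp add: br_bilinear br_e_e br_comb_e del: One_nat_def)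
  then have "b = 0" using e_nonzero[of 3] by simp
  show ?thesis using that[of a q] ap bq \<open>p = 0\<close> \<open>b = 0\<close> by simp
qed

lemma right_mult_e:
  assumes "br (e 1) x = a *s e 1" "br (e 2) x = comb e 2 q" "i \<ge> 2"
  shows "br (e i) x = (a * (of_nat i - 2)) *s e i + comb e i q"
  using \<open>i \<ge> 2\<close>
proof (induction i rule: dec_induct)
  case base
  show ?case using assms by simp
next
  case (step n)
  have "br (e (Suc n)) x = br (br (e n) (e 1)) x"
    using step by (simp add: br_e_e1 del: One_nat_def)
  also have "\<dots> = br (e n) (br (e 1) x) + br (br (e n) x) (e 1)"
    by (rule derivation_right)
  also have "\<dots> = (a * (of_nat (Suc n) - 2)) *s e (Suc n) + comb e (Suc n) q"
    unfolding step.IH assms(1) using step.hyps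
    by (simp add: br_bilinear br_e_e1 br_comb_e1 del: One_nat_def)
      (simp flip: scale_left_distrib add.assoc add: ring_distribs)
  finally show ?case .
qed

text \<open>Squares and symmetrised products are killed by \<open>[e\<^sub>2,_]\<close>, hence have no \<open>e\<^sub>1\<close>-coordinate by
  \<open>br_e2\<close>; they are also killed by \<open>[x,_]\<close>, which covers \<open>e\<^sub>i\<^sub>+\<^sub>1 = [e\<^sub>i,e\<^sub>1] + [e\<^sub>1,e\<^sub>i]\<close> for
  \<open>i \<ge> 2\<close>.  The last conclusion is the Leibniz identity for \<open>x, x, e\<^sub>1\<close>.\<close>

lemma left_mult:
  assumes "complement x" "br (e 1) x = a *s e 1" "br (e 2) x = comb e 2 q"
  obtains r u where "br x (e 1) = - (a *s e 1) + comb e 2 r" "br x x = comb e 2 u"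
    and "\<And>i. i \<ge> 2 \<Longrightarrow> br x (e i) = 0"
    and "br (comb e 2 r) x = a *s comb e 2 r + comb e 3 u"
proof -
  have "br x (e 1) \<in> N" "br x (e 2) \<in> N"
    using ideal_N e_in_N by (auto simp: ideal_def)
  then obtain c r s1 s where cr: "br x (e 1) = c *s e 1 + comb e 2 r"
    and s: "br x (e 2) = s1 *s e 1 + comb e 2 s"
    by (metis in_N_cases)
  obtain g u where gu: "br x x = g *s e 1 + comb e 2 u"
    using br_in_N[OF assms(1)] by (metis in_N_cases)
  have e3: "k = 0" if "k *s e 3 = 0" for k using that e_nonzero[of 3] by simp
  have g: "g = 0"
    using br_square_right[of "e 2" x] unfolding gu br_e2 by (rule e3)
  have "br (e 2) ((a + c) *s e 1 + comb e 2 r) = 0"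
    using br_symmetric_right[of "e 2" "e 1" x] assms(2) cr
    by (simp add: algebra_simps)
  then have c: "c = - a" unfolding br_e2 using e3 by (metis add_eq_0_iff)
  have "br (e 2) (s1 *s e 1 + comb e 2 (s + q)) = 0"
    using br_symmetric_right[of "e 2" "e 2" x] assms(3) s
    by (simp add: algebra_simps comb_add)
  then have s1: "s1 = 0" unfolding br_e2 by (rule e3)
  have x3: "br x (e (Suc i)) = 0" if "i \<ge> 2" for i
    using br_symmetric_right[of x "e i" "e 1"] that br_e_e[of 1 i] by (simp add: br_e_e1 del: One_nat_def)
  \<comment> \<open>The vector \<open>e\<^sub>2\<close> is not a symmetrised product; that \<open>x\<close> kills it follows from \<open>[x,e\<^sub>3] = 0\<close>
    because the shift is injective on \<open>V\<close>.\<close>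
  have "comb e 3 s = 0"
    using leibniz[of x "e 2" "e 1"] x3[of 2]
    by (simp add: br_e_e1 s s1 cr br_bilinear br_comb_e1 br_comb_e br_e_e del: One_nat_def)
  then have s0: "br x (e 2) = 0" by (simp add: s s1 comb_eq_0_iff)
  have xi: "br x (e i) = 0" if "i \<ge> 2" for i
    using that s0 x3[of "i - 1"] by (cases "i = 2") auto
  have "br (comb e 2 r) x = a *s comb e 2 r + comb e 3 u"
    using leibniz[of x x "e 1"]
    by (simp add: cr c gu g br_bilinear assms(2) br_comb_e1 br_comb_right_zero[OF xi]
        algebra_simps del: One_nat_def)
  then show ?thesis using that cr c gu g xi by simp
qed

text \<open>The conditions \<open>[e\<^sub>1,x] = 0\<close> and \<open>q(0) = 0\<close> say that \<open>[_,x]\<close>, like \<open>[_,e\<^sub>1]\<close>, strictly lowers the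
  filtration of \<open>V\<close>.  The lower central series is therefore squeezed between two shifts of this
  filtration: it has zero intersection by \<open>comb_shift\<close>, and its terms have finite codimension because
  they contain almost all \<open>e\<^sub>j\<close>.\<close>

lemma pro_nilpotent_UNIV:
  assumes x: "complement x" "br (e 1) x = 0" "br (e 2) x = comb e 2 q" and q0: "coeff q 0 = 0"
  shows "pro_nilpotent UNIV"
proof -
  obtain q' where q: "q = pCons 0 q'" using q0 by (cases q) auto
  have e1x: "br (e 1) x = 0 *s e 1" using x(2) by simp
  obtain r u where ru: "br x (e 1) = comb e 2 r" "br x x = comb e 2 u"
    and x0: "\<And>i. i \<ge> 2 \<Longrightarrow> br x (e i) = 0"
    using left_mult[OF x(1) e1x x(3)] by (metis add_0 minus_zero scale_zero_left)
  define G where "G = insert x (e ` {1..})"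
  define V where "V i = span (e ` {i..})" for i
  have sV: "subspace (V i)" for i by (simp add: V_def)
  have UN: "UNIV = span G"
    using is_basis_complement[OF x(1)] by (simp add: is_basis_def G_def)
  have cases_G: "c = x \<or> c = e 1 \<or> (\<exists>j\<ge>2. c = e j)" if "c \<in> G" for c
  proof -
    have "j = 1 \<or> j \<ge> 2" if "j \<ge> 1" for j :: nat using that by linarith
    then show ?thesis using that unfolding G_def by auto
  qed
  have eV: "e j \<in> V i" if "j \<ge> i" for i j using that by (auto simp: V_def intro: span_base)
  have combV: "comb e i p \<in> V i" for i p by (simp add: V_def comb_in_span)
  have V0: "0 \<in> V i" for i using sV by (rule subspace_0)
  have V_decr: "V i \<subseteq> V j" if "j \<le> i" for i j
    unfolding V_def using that by (intro span_mono) auto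
  have step: "br (e i) b \<in> V (Suc i)" if "i \<ge> 2" "b \<in> G" for i b
  proof -
    consider "b = x" | "b = e 1" | j where "j \<ge> 2" "b = e j"
      using cases_G \<open>b \<in> G\<close> by blast
    then show ?thesis
    proof cases
      case 1
      have "br (e i) x = comb e (Suc i) q'"
        using right_mult_e[OF e1x x(3) that(1)] by (simp add: q comb_Suc)
      then show ?thesis using 1 combV by simp
    next
      case 2
      then show ?thesis using that eV by (simp add: br_e_e1 del: One_nat_def)
    next
      case 3
      then show ?thesis using that V0 br_e_e by simp
    qed
  qed
  have base: "br a b \<in> V 2" if "a \<in> G" "b \<in> G" for a b
  proof -
    show ?thesis
    proof (cases "\<exists>j\<ge>2. a = e j")
      case True
      then obtain j where j: "j \<ge> 2" "a = e j" by blast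
      then show ?thesis using step[OF j(1) that(2)] V_decr[of 2 "Suc j"] by auto
    next
      case False
      then have "a = x \<or> a = e 1" using cases_G[OF that(1)] by blast
      then show ?thesis
        using cases_G[OF that(2)] combV[of 2] V0[of 2] br_e_e[of 1]
        by (auto simp: ru x0 x(2) br_e1_e1 simp del: One_nat_def)
    qed
  qed
  have upper: "lower_central UNIV (Suc k) \<subseteq> V (k + 2)" for k
  proof (induction k)
    case 0
    have "set_br (span G) (span G) \<subseteq> V 2"
      by (rule set_br_span_subset[OF sV base])
    then show ?case by (simp flip: UN add: numeral_2_eq_2)
  next
    case (Suc k)
    have "set_br (V (k + 2)) UNIV \<subseteq> V (Suc k + 2)"
      unfolding UN V_def[of "k + 2"]
    proof (rule set_br_span_subset[OF sV])
      fix a b assume "a \<in> e ` {k + 2..}" "b \<in> G"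
      then obtain i where i: "a = e i" "i \<ge> k + 2" by auto
      have "br (e i) b \<in> V (Suc i)" using i \<open>b \<in> G\<close> by (intro step) auto
      then show "br a b \<in> V (Suc k + 2)" using V_decr[of "Suc k + 2" "Suc i"] i by auto
    qed
    moreover have "lower_central UNIV (Suc (Suc k)) \<subseteq> set_br (V (k + 2)) UNIV"
      using set_br_mono[OF Suc] by simp
    ultimately show ?case by blast
  qed
  have lower: "e j \<in> lower_central UNIV k" if "j \<ge> k + 2" for j k
    using that
  proof (induction k arbitrary: j)
    case (Suc k)
    then have "br (e (j - 1)) (e 1) \<in> lower_central UNIV (Suc k)"
      by (simp add: br_in_set_br)
    moreover have "br (e (j - 1)) (e 1) = e j"
      using Suc.prems br_e_e1[of "j - 1"] by simp
    ultimately show ?case by simp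
  qed simp
  have sub: "subspace (lower_central UNIV k)" for k
    by (cases k) (simp_all add: set_br_def)
  have "z = 0" if z: "\<And>k. z \<in> lower_central UNIV k" for z
  proof -
    have rep: "\<exists>p. z = comb e (2 + k) p" for k
      using upper[of k] z[of "Suc k"] span_eq_range_comb[of e "k + 2"] by (auto simp: V_def add.commute)
    obtain p where p: "z = comb e 2 p" using rep[of 0] by auto
    have "coeff p j = 0" for j
    proof -
      obtain s where "z = comb e (2 + Suc j) s" using rep[of "Suc j"] by auto
      then have "p = monom 1 (Suc j) * s"
        using p comb_eq_iff[of 2] comb_shift[of e 2 "Suc j" s] by simp
      then show ?thesis by (simp add: coeff_monom_mult)
    qed
    then have "p = 0" by (intro poly_eqI) simp
    then show ?thesis using p by simp
  qed
  then have "(\<Inter>k. lower_central UNIV k) = {0}"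
    using subspace_0[OF sub] by auto
  moreover have "finite_dim_quotient UNIV (lower_central UNIV k)" for k
  proof (rule finite_dim_quotientI[OF _ _ sub])
    let ?S = "insert x (e ` {1..<k + 2})"
    show "finite ?S" by simp
    have "G \<subseteq> ?S \<union> lower_central UNIV k"
    proof
      fix v assume "v \<in> G"
      then consider "v = x" | j where "j \<ge> 1" "v = e j" by (auto simp: G_def)
      then show "v \<in> ?S \<union> lower_central UNIV k"
      proof cases
        case 2
        then show ?thesis using lower[of k j] by (cases "j < k + 2") auto
      qed simp
    qed
    then show "span (?S \<union> lower_central UNIV k) = UNIV"
      using UN span_mono by blast
  qed
  ultimately show ?thesis by (simp add: pro_nilpotent_def)
qed

section \<open>Normal forms\<close>

text \<open>If \<open>r = \<rho> + T r'\<close> in \<open>left_mult\<close>, subtracting \<open>r'(T) e\<^sub>2\<close> from \<open>x\<close> leaves \<open>[_,x]\<close> unchanged on \<open>N\<close>, as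
  \<open>[N,V] = 0\<close>, and cancels \<open>T r'\<close> in \<open>[x,e\<^sub>1]\<close>.  The last conclusion is the relation of \<open>left_mult\<close>
  read in \<open>\<complex>[T]\<close>.\<close>

lemma normalized_complement:
  assumes x: "complement x" "br (e 1) x = a *s e 1" "br (e 2) x = comb e 2 q"
  obtains y \<rho> u where "complement y" "br (e 1) y = a *s e 1" "br (e 2) y = comb e 2 q"
    "br y (e 1) = - (a *s e 1) + \<rho> *s e 2" "br y y = comb e 2 u"
    "\<And>i. i \<ge> 2 \<Longrightarrow> br y (e i) = 0" "smult \<rho> q = pCons (a * \<rho>) u"
proof -
  obtain r where "br x (e 1) = - (a *s e 1) + comb e 2 r"
    using left_mult[OF x] by metis
  moreover obtain \<rho> r' where "r = pCons \<rho> r'" by (cases r)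
  ultimately have xe1: "br x (e 1) = - (a *s e 1) + \<rho> *s e 2 + comb e 3 r'"
    by (simp add: comb_pCons add.assoc)
  define y where "y = x - comb e 2 r'"
  have y: "complement y" "br (e 1) y = a *s e 1" "br (e 2) y = comb e 2 q"
    using x comb_in_N[of 2] by (simp_all add: y_def complement_diff br_bilinear br_e_comb del: One_nat_def)
  have ye1: "br y (e 1) = - (a *s e 1) + \<rho> *s e 2"
    by (simp add: y_def br_bilinear br_comb_e1 xe1 del: One_nat_def)
  obtain s u where su: "br y (e 1) = - (a *s e 1) + comb e 2 s" "br y y = comb e 2 u"
    and y0: "\<And>i. i \<ge> 2 \<Longrightarrow> br y (e i) = 0"
    and rel: "br (comb e 2 s) y = a *s comb e 2 s + comb e 3 u"
    using left_mult[OF y] by metis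
  have s: "comb e 2 s = \<rho> *s e 2" using su(1) ye1 by simp
  have "comb e 2 (smult \<rho> q) = comb e 2 (pCons (a * \<rho>) u)"
    using rel unfolding s by (simp add: br_bilinear y(3) comb_smult comb_pCons)
  then have "smult \<rho> q = pCons (a * \<rho>) u" by (simp add: comb_eq_iff)
  then show ?thesis using that[OF y ye1 su(2) y0] by simp
qed

text \<open>The parameter \<open>\<beta>\<^sub>k\<close> is the coefficient of \<open>T\<^bsup>k-2\<^esup>\<close> in \<open>q\<close>, hence of \<open>T\<^bsup>k-3\<^esup>\<close> in \<open>p\<close> when
  \<open>q = b + T p\<close>; so \<open>t = degree p + 3\<close> is large enough.\<close>

lemma table_sum:
  assumes "\<And>k. k \<ge> 3 \<Longrightarrow> \<beta> k = coeff p (k - 3)"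
  shows "(\<Sum>k=3..degree p + 3. \<beta> k *s e (k + i - 2)) = comb e (Suc i) p"
proof -
  have "(\<Sum>k=0 + 3..degree p + 3. \<beta> k *s e (k + i - 2)) = (\<Sum>j=0..degree p. \<beta> (j + 3) *s e (j + 3 + i - 2))"
    by (rule sum.shift_bounds_cl_nat_ivl)
  also have "\<dots> = comb e (Suc i) p"
    unfolding comb_def atMost_atLeast0 by (intro sum.cong) (simp_all add: assms algebra_simps)
  finally show ?thesis by simp
qed

lemma R1_tableI:
  assumes "br (e 1) y = e 1" "br (e 2) y = comb e 2 (pCons b p)" "br y (e 1) = - e 1"
    "br y y = 0" "\<And>i. i \<ge> 2 \<Longrightarrow> br y (e i) = 0"
  shows "R1_table (degree p + 3) (\<lambda>k. if k = 2 then b else coeff p (k - 3)) y e"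
  using right_mult_e[of y 1 "pCons b p"] assms
  unfolding R1_table_def
  by (subst table_sum) (simp_all add: F_table_e comb_pCons algebra_simps del: One_nat_def)

lemma R2_tableI:
  assumes "br (e 1) y = e 1" "br (e 2) y = comb e 2 (pCons 1 p)" "br y (e 1) = - e 1 + e 2"
    "br y y = comb e 2 p" "\<And>i. i \<ge> 2 \<Longrightarrow> br y (e i) = 0"
  shows "R2_table (degree p + 3) (\<lambda>k. coeff p (k - 3)) y e"
proof -
  have "(\<Sum>k=0 + 2..degree p + 2. coeff p (k + 1 - 3) *s e k) = (\<Sum>j=0..degree p. coeff p (j + 2 + 1 - 3) *s e (j + 2))"
    by (rule sum.shift_bounds_cl_nat_ivl)
  also have "\<dots> = comb e 2 p"
    unfolding comb_def atMost_atLeast0 by (intro sum.cong) simp_all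
  finally have xx: "(\<Sum>k=2..degree p + 3 - 1. coeff p (k + 1 - 3) *s e k) = comb e 2 p"
    by (simp add: numeral_2_eq_2)
  have "br (e i) y = (of_nat i - 1) *s e i + comb e (Suc i) p" if "i \<ge> 2" for i
  proof -
    have "br (e i) y = (of_nat i - 2) *s e i + (1 *s e i + comb e (Suc i) p)"
      using right_mult_e[of y 1 "pCons 1 p" i] assms(1,2) that by (simp add: comb_pCons)
    then show ?thesis by (simp flip: scale_left_distrib add.assoc del: scale_one)
  qed
  then show ?thesis
    using assms unfolding R2_table_def xx
    by (subst table_sum) (simp_all add: F_table_e del: One_nat_def)
qed

lemma R3_tableI:
  assumes "br (e 1) y = 0" "br (e 2) y = comb e 2 (pCons 1 p)" "br y (e 1) = 0"
    "br y y = 0" "\<And>i. i \<ge> 2 \<Longrightarrow> br y (e i) = 0"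
  shows "R3_table (degree p + 3) (\<lambda>k. coeff p (k - 3)) y e"
proof -
  have "br y (e i) = 0" if "i \<ge> 1" for i
    using that assms(3,5) by (cases "i = 1") auto
  then show ?thesis
    using right_mult_e[of y 0 "pCons 1 p"] assms
    unfolding R3_table_def
    by (subst table_sum) (simp_all add: F_table_e comb_pCons algebra_simps del: One_nat_def)
qed

definition rescaled :: "complex \<Rightarrow> nat \<Rightarrow> 'a" where
  "rescaled \<rho> i = (if i = 1 then e 1 else \<rho> *s e i)"

lemma comb_rescaled: "i \<ge> 2 \<Longrightarrow> comb (rescaled \<rho>) i p = \<rho> *s comb e i p"
  by (induction p arbitrary: i) (simp_all add: comb_pCons rescaled_def algebra_simps)

text \<open>Scaling \<open>V\<close> by a nonzero factor and fixing \<open>e\<^sub>1\<close> is an automorphism of F, so everything proved for \<open>e\<close> also holds for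
  the rescaled basis.\<close>

lemma F_ideal_rescaled:
  assumes "\<rho> \<noteq> 0"
  shows "F_ideal scale br (rescaled \<rho>) N"
proof -
  define c where "c = (\<lambda>v. if v = e 1 then 1 else \<rho>)"
  have eq: "rescaled \<rho> i = c (e i) *s e i" if "i \<ge> 1" for i
    using inj_onD[OF inj_e, of i 1] that by (auto simp: rescaled_def c_def)
  have img: "rescaled \<rho> ` {1..} = (\<lambda>v. c v *s v) ` e ` {1..}"
    unfolding image_image using eq by (intro image_cong) auto
  have c: "c v \<noteq> 0" for v using assms by (simp add: c_def)
  note R = independent_rescale[OF independent_e, of c, OF c]
  have "inj_on (rescaled \<rho>) {1..}"
    using comp_inj_on[OF inj_e R(1)] eq by (simp add: inj_on_def)
  moreover have "F_table (rescaled \<rho>)"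
    using F_table_e by (simp add: F_table_def rescaled_def br_bilinear)
  ultimately show ?thesis
    using R span_e ideal_N img by unfold_locales simp_all
qed

lemma classification:
  assumes "complement x" "\<not> pro_nilpotent UNIV"
  shows "\<exists>x e. is_basis x e \<and> (\<exists>t\<ge>2. \<exists>\<beta>. R1_table t \<beta> x e \<or> R2_table t \<beta> x e \<or> R3_table t \<beta> x e)"
proof -
  obtain a q where aq: "br (e 1) x = a *s e 1" "br (e 2) x = comb e 2 q"
    using right_mult[OF assms(1)] .
  show ?thesis
  proof (cases "a = 0")
    case False
    have sc: "complement (inverse a *s x)" "br (e 1) (inverse a *s x) = 1 *s e 1"
      "br (e 2) (inverse a *s x) = comb e 2 (smult (inverse a) q)"
      using assms(1) False aq by (simp_all add: complement_scale br_bilinear comb_smult del: One_nat_def)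
    obtain y \<rho> u where y: "complement y" "br (e 1) y = e 1"
      "br (e 2) y = comb e 2 (smult (inverse a) q)"
      "br y (e 1) = - e 1 + \<rho> *s e 2" "br y y = comb e 2 u" "\<And>i. i \<ge> 2 \<Longrightarrow> br y (e i) = 0"
      and rel: "smult \<rho> (smult (inverse a) q) = pCons \<rho> u"
      using normalized_complement[OF sc] by (metis mult_1 scale_one)
    show ?thesis
    proof (cases "\<rho> = 0")
      case True
      obtain b p where "smult (inverse a) q = pCons b p" by (cases "smult (inverse a) q")
      moreover have "u = 0" using rel True by simp
      ultimately have "R1_table (degree p + 3) (\<lambda>k. if k = 2 then b else coeff p (k - 3)) y e"
        using y True by (intro R1_tableI) simp_all
      moreover have "2 \<le> degree p + 3" by simp
      ultimately show ?thesis using is_basis_complement[OF y(1)] by blast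
    next
      case False
      interpret R: F_ideal scale br "rescaled \<rho>" N
        by (rule F_ideal_rescaled[OF False])
      define p where "p = smult (inverse \<rho>) u"
      have "smult (inverse \<rho>) (smult \<rho> (smult (inverse a) q)) = pCons 1 p"
        unfolding rel p_def using False by simp
      then have q: "smult (inverse a) q = pCons 1 p"
        using False by (simp flip: mult.assoc)
      have "R2_table (degree p + 3) (\<lambda>k. coeff p (k - 3)) y (rescaled \<rho>)"
      proof (rule R.R2_tableI)
        show "br (rescaled \<rho> 2) y = comb (rescaled \<rho>) 2 (pCons 1 p)"
          using y(3) q by (simp add: comb_rescaled) (simp add: rescaled_def br_bilinear)
        show "br y y = comb (rescaled \<rho>) 2 p"
          using y(5) False by (simp add: comb_rescaled p_def comb_smult)
      qed (use y in \<open>simp_all add: rescaled_def br_bilinear\<close>)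
      moreover have "is_basis y (rescaled \<rho>)"
        using y(1) by (intro R.is_basis_complement) (simp add: complement_def R.complement_def)
      moreover have "2 \<le> degree p + 3" by simp
      ultimately show ?thesis by blast
    qed
  next
    case True
    define b where "b = coeff q 0"
    have b: "b \<noteq> 0" using pro_nilpotent_UNIV assms aq True by (auto simp: b_def)
    have sc: "complement (inverse b *s x)" "br (e 1) (inverse b *s x) = 0 *s e 1"
      "br (e 2) (inverse b *s x) = comb e 2 (smult (inverse b) q)"
      using assms(1) b True aq by (simp_all add: complement_scale br_bilinear comb_smult del: One_nat_def)
    obtain y \<rho> u where y: "complement y" "br (e 1) y = 0"
      "br (e 2) y = comb e 2 (smult (inverse b) q)"
      "br y (e 1) = \<rho> *s e 2" "br y y = comb e 2 u" "\<And>i. i \<ge> 2 \<Longrightarrow> br y (e i) = 0"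
      and rel: "smult \<rho> (smult (inverse b) q) = pCons 0 u"
      using normalized_complement[OF sc] by (metis mult_zero_left scale_zero_left minus_zero add_0)
    obtain c p where cp: "smult (inverse b) q = pCons c p" by (cases "smult (inverse b) q")
    have "c = coeff (smult (inverse b) q) 0" using cp by simp
    then have "c = 1" using b by (simp add: b_def)
    moreover from this have "\<rho> = 0" "u = 0" using rel cp by auto
    ultimately have "R3_table (degree p + 3) (\<lambda>k. coeff p (k - 3)) y e"
      using y cp by (intro R3_tableI) simp_all
    moreover have "2 \<le> degree p + 3" by simp
    ultimately show ?thesis using is_basis_complement[OF y(1)] by blast
  qed
qed

end

theorem theorem3p7:
  fixes scale :: "complex \<Rightarrow> 'a::ab_group_add \<Rightarrow> 'a"
    and br :: "'a \<Rightarrow> 'a \<Rightarrow> 'a"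
    and N :: "'a set"
  assumes "leibniz_algebra scale br"
    and "leibniz_algebra.residually_solvable scale br UNIV"
    and "leibniz_algebra.maximal_pro_nilpotent_ideal scale br N"
    and "leibniz_algebra.is_F scale br N"
    and "leibniz_algebra.has_codim scale UNIV N 1"
  shows "\<exists>x e. leibniz_algebra.is_basis scale x e \<and>
           (\<exists>t\<ge>2. \<exists>\<beta>. leibniz_algebra.R1_table scale br t \<beta> x e
                     \<or> leibniz_algebra.R2_table scale br t \<beta> x e
                     \<or> leibniz_algebra.R3_table scale br t \<beta> x e)"
proof -
  interpret leibniz_algebra scale br by (rule assms(1))
  obtain e where "inj_on e {1..}" "independent (e ` {1..})" "span (e ` {1..}) = N" "F_table e"
    using assms(4) unfolding is_F_def by blast
  moreover have "ideal N"
    using assms(3) by (simp add: maximal_pro_nilpotent_ideal_def)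
  ultimately interpret F_ideal scale br e N by unfold_locales
  obtain B where B: "card B = 1" "quotient_basis UNIV N B"
    using assms(5) unfolding has_codim_def by blast
  then obtain x where "B = {x}" by (auto simp: card_1_singleton_iff)
  with B have sp: "span (insert x N) = UNIV"
    and ind: "\<And>c. (\<Sum>v\<in>{x}. scale (c v) v) \<in> N \<Longrightarrow> \<forall>v\<in>{x}. c v = 0"
    unfolding quotient_basis_def by (simp, blast)
  have "x \<notin> N" using ind[of "\<lambda>_. 1"] by auto
  with sp have x: "complement x" by (simp add: complement_def)
  have "\<not> pro_nilpotent UNIV"
  proof
    assume "pro_nilpotent UNIV"
    moreover have "ideal UNIV" by (simp add: ideal_def)
    ultimately have "UNIV = N"
      using assms(3) unfolding maximal_pro_nilpotent_ideal_def by blast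
    with \<open>x \<notin> N\<close> show False by auto
  qed
  with x show ?thesis by (rule classification)
qed

end
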